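(* Let $\mathbb{H}$ be an elementary abelian $2$-hypergroup and let $\mathbb{G}\subseteq\mathbb{H}$. Then $\mathbb{G}$ is a closed subset of $\mathbb{H}$ if and only if there exist $r\in\mathrm{Thick}(\mathbb{H})$ and $\mathbb{F}\subseteq\mathbb{H}$ such that $\mathrm{O}^\vartheta(\mathbb{G})=\langle r\rangle$, $\mathbb{F}^\gamma$ is a subgroup of the elementary abelian $2$-group $\mathrm{O}_\vartheta(\mathbb{H})^\gamma$, $\mathbb{G}=\langle r\rangle\mathbb{F}$, $\langle r\rangle\cap\mathbb{F}=\{e\}$, and $\mathrm{O}_\vartheta(\mathbb{G})=\mathbb{F}$.
   Context: A hypergroup is a nonempty set $\mathbb{H}$ with a hypermultiplication $(a,b)\mapsto ab\subseteq\mathbb{H}$ and a map $a\mapsto a^*$ from $\mathbb{H}$ to $\mathbb{H}$ such that, writing $\mathbb{F}\mathbb{G}=\bigcup_{b\in\mathbb{F},c\in\mathbb{G}}bc$ for $\mathbb{F},\mathbb{G}\subseteq\mathbb{H}$ and $a\mathbb{G}=\{a\}\mathbb{G}$, $\mathbb{G}a=\mathbb{G}\{a\}$: (1) $(ab)c=a(bc)$ for all $a,b,c$; (2) there is a unique $e\in\mathbb{H}$ with $ea=\{a\}=ae$ for all $a$; (3) for all $a,b,c$ the conditions $a\in bc$, $b\in ac^*$, $c\in b^*a$ are pairwise equivalent. A nonempty $\mathbb{G}\subseteq\mathbb{H}$ is a closed subset of $\mathbb{H}$ if $\mathbb{G}^*\mathbb{G}\subseteq\mathbb{G}$, where $\mathbb{G}^*=\{a^*:a\in\mathbb{G}\}$.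 For $\mathbb{G}\subseteq\mathbb{H}$, $\langle\mathbb{G}\rangle$ is the intersection of all closed subsets of $\mathbb{H}$ containing $\mathbb{G}$, and $\langle a\rangle=\langle\{a\}\rangle$. An element $a$ is thin if $a^*a=\{e\}$ and thick otherwise. $\mathrm{O}_\vartheta(\mathbb{G})$ is the set of thin elements of $\mathbb{H}$ lying in $\mathbb{G}$. For closed subsets $\mathbb{F},\mathbb{G}$: $\mathbb{F}$ is normal in $\mathbb{G}$ if $\mathbb{F}\subseteq\mathbb{G}$ and $\mathbb{F}a=a\mathbb{F}$ for all $a\in\mathbb{G}$; $\mathbb{F}$ is strongly normal in $\mathbb{G}$ if $a^*\mathbb{F}a\subseteq\mathbb{F}\subseteq\mathbb{G}$ for all $a\in\mathbb{G}$. For $\mathbb{G}\subseteq\mathbb{H}$, $\mathrm{O}^\vartheta(\mathbb{G})$ is the intersection of all strongly normal closed subsets of $\langle\mathbb{G}\rangle$. An involution is an element $a\neq e$ such that $\{e,a\}$ is closed. If $a,b$ are thin, then $ab$ is a singleton $\{c\}$ with $c$ thin. For $\mathbb{G}\subseteq\mathbb{H}$ put $\mathbb{G}^\gamma=\{\{a\}:a\in\mathbb{G}\}$; $\mathrm{O}_\vartheta(\mathbb{H})^\gamma$ carries the binary operation $\{a\}\bullet\{b\}=ab$ with identity $\{e\}$. Elementary abelian $2$-hypergroups: $\mathbb{H}$ is the direct product of normal closed subsets $\mathbb{G}_1,\dots,\mathbb{G}_p$ ($p\geq 1$) if, for each $i$, $\mathbb{H}=\mathbb{G}_i\widehat{\mathbb{G}_i}$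 and $\mathbb{G}_i\cap\widehat{\mathbb{G}_i}=\{e\}$, where $\widehat{\mathbb{G}_i}=\prod_{j\neq i}\mathbb{G}_j$ (and $\widehat{\mathbb{G}_1}=\{e\}$ if $p=1$). Then for every $a\in\mathbb{H}$ there are unique $r_i\in\mathbb{G}_i$ ($1\le i\le p$) with $a\in r_1r_2\cdots r_p$; the set $\{r_1,\dots,r_p\}\setminus\{e\}$ is the support of $a$. The direct product is constrained if $r_1r_2\cdots r_p=\{a\}$ for every $a\in\mathbb{H}$. $\mathbb{H}$ is an elementary abelian $2$-hypergroup if it is the constrained direct product of closed subsets $\langle q_1\rangle,\dots,\langle q_p\rangle$ with $q_1,\dots,q_p$ involutions of $\mathbb{H}$ (so $\langle q_i\rangle=\{e,q_i\}$); $q_1,\dots,q_p$ are fixed and supports are taken with respect to this decomposition. For $\mathbb{F}\subseteq\mathbb{H}$, $\mathrm{Thick}(\mathbb{F})$ is the set of $a\in\mathbb{F}$ such that $a=e$ or all elements in the support of $a$ are thick.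
   Formalization: Thick(F) is taken to be the set of a in F with a = e or all elements of the support of a thick (not thin, as written); with "thin" the claim fails for H = G = {e,q}, qq = {e,q}, where the thin residue of G is H but Thick(H) = {e}. *)

theory Defs
  imports "HOL-Algebra.Group"
begin

section \<open>Hypergroups\<close>

text \<open>The identity element is not a field of the record: as in the axioms, it is only required
  to exist uniquely, and \<open>hid\<close> below names it.\<close>

record 'a hyperstructure = "'a partial_object" +
  hmult :: "'a \<Rightarrow> 'a \<Rightarrow> 'a set"
  star :: "'a \<Rightarrow> 'a"

definition cprod :: "('a, 'b) hyperstructure_scheme \<Rightarrow> 'a set \<Rightarrow> 'a set \<Rightarrow> 'a set"
    (infixl "\<odot>\<index>" 70)
  where "F \<odot>\<^bsub>H\<^esub> G = (\<Union>b\<in>F. \<Union>c\<in>G. hmult H b c)"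

definition is_hid :: "('a, 'b) hyperstructure_scheme \<Rightarrow> 'a \<Rightarrow> bool"
  where "is_hid H e \<longleftrightarrow>
    e \<in> carrier H \<and> (\<forall>a\<in>carrier H. hmult H e a = {a} \<and> hmult H a e = {a})"

definition hid :: "('a, 'b) hyperstructure_scheme \<Rightarrow> 'a"
  where "hid H = (THE e. is_hid H e)"

locale hypergroup =
  fixes H :: "('a, 'b) hyperstructure_scheme" (structure)
  assumes nonempty: "carrier H \<noteq> {}"
    and hmult_closed: "\<lbrakk>a \<in> carrier H; b \<in> carrier H\<rbrakk> \<Longrightarrow> hmult H a b \<subseteq> carrier H"
    and star_closed: "a \<in> carrier H \<Longrightarrow> star H a \<in> carrier H"
    and hassoc: "\<lbrakk>a \<in> carrier H; b \<in> carrier H; c \<in> carrier H\<rbrakk>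
      \<Longrightarrow> hmult H a b \<odot> {c} = {a} \<odot> hmult H b c"
    and ex1_hid: "\<exists>!e. is_hid H e"
    and exchange1: "\<lbrakk>a \<in> carrier H; b \<in> carrier H; c \<in> carrier H\<rbrakk>
      \<Longrightarrow> a \<in> hmult H b c \<longleftrightarrow> b \<in> hmult H a (star H c)"
    and exchange2: "\<lbrakk>a \<in> carrier H; b \<in> carrier H; c \<in> carrier H\<rbrakk>
      \<Longrightarrow> a \<in> hmult H b c \<longleftrightarrow> c \<in> hmult H (star H b) a"

definition closed_subset :: "('a, 'b) hyperstructure_scheme \<Rightarrow> 'a set \<Rightarrow> bool"
  where "closed_subset H G \<longleftrightarrow>
    G \<subseteq> carrier H \<and> G \<noteq> {} \<and> (star H ` G) \<odot>\<^bsub>H\<^esub> G \<subseteq> G"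

definition hgen :: "('a, 'b) hyperstructure_scheme \<Rightarrow> 'a set \<Rightarrow> 'a set"
  where "hgen H G = \<Inter>{F. closed_subset H F \<and> G \<subseteq> F}"

definition thin :: "('a, 'b) hyperstructure_scheme \<Rightarrow> 'a \<Rightarrow> bool"
  where "thin H a \<longleftrightarrow> a \<in> carrier H \<and> hmult H (star H a) a = {hid H}"

definition thick :: "('a, 'b) hyperstructure_scheme \<Rightarrow> 'a \<Rightarrow> bool"
  where "thick H a \<longleftrightarrow> a \<in> carrier H \<and> \<not> thin H a"

text \<open>\<open>thin_part\<close> is $\mathrm{O}_\vartheta$ and \<open>thin_residue\<close> is $\mathrm{O}^\vartheta$.\<close>

definition thin_part :: "('a, 'b) hyperstructure_scheme \<Rightarrow> 'a set \<Rightarrow> 'a set"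
  where "thin_part H G = {a \<in> G. thin H a}"

definition normal_in :: "('a, 'b) hyperstructure_scheme \<Rightarrow> 'a set \<Rightarrow> 'a set \<Rightarrow> bool"
  where "normal_in H F G \<longleftrightarrow> closed_subset H F \<and> closed_subset H G \<and>
    F \<subseteq> G \<and> (\<forall>a\<in>G. F \<odot>\<^bsub>H\<^esub> {a} = {a} \<odot>\<^bsub>H\<^esub> F)"

definition strongly_normal_in :: "('a, 'b) hyperstructure_scheme \<Rightarrow> 'a set \<Rightarrow> 'a set \<Rightarrow> bool"
  where "strongly_normal_in H F G \<longleftrightarrow> closed_subset H F \<and> closed_subset H G \<and>
    F \<subseteq> G \<and> (\<forall>a\<in>G. {star H a} \<odot>\<^bsub>H\<^esub> F \<odot>\<^bsub>H\<^esub> {a} \<subseteq> F)"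

definition thin_residue :: "('a, 'b) hyperstructure_scheme \<Rightarrow> 'a set \<Rightarrow> 'a set"
  where "thin_residue H G = \<Inter>{F. strongly_normal_in H F (hgen H G)}"

definition involution :: "('a, 'b) hyperstructure_scheme \<Rightarrow> 'a \<Rightarrow> bool"
  where "involution H a \<longleftrightarrow>
    a \<in> carrier H \<and> a \<noteq> hid H \<and> closed_subset H {hid H, a}"

definition singletons :: "'a set \<Rightarrow> 'a set set"
  where "singletons G = {{a} | a. a \<in> G}"

text \<open>The group of singletons of thin elements; on such singletons the complex product is
  $\{a\} \bullet \{b\} = ab$.\<close>

definition thin_group :: "('a, 'b) hyperstructure_scheme \<Rightarrow> 'a set monoid"
  where "thin_group H =
    \<lparr>carrier = singletons (thin_part H (carrier H)), mult = cprod H, one = {hid H}\<rparr>"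


section \<open>Direct products and elementary abelian 2-hypergroups\<close>

text \<open>The product $G_1 \cdots G_p$ of a list of subsets; it is $\{e\}$ for the empty list.
  The trailing factor $\{e\}$ is neutral.\<close>

definition lprod :: "('a, 'b) hyperstructure_scheme \<Rightarrow> 'a set list \<Rightarrow> 'a set"
  where "lprod H Gs = foldr (cprod H) Gs {hid H}"

definition cofactor :: "('a, 'b) hyperstructure_scheme \<Rightarrow> 'a set list \<Rightarrow> nat \<Rightarrow> 'a set"
  where "cofactor H Gs i = lprod H (take i Gs @ drop (Suc i) Gs)"

definition direct_product :: "('a, 'b) hyperstructure_scheme \<Rightarrow> 'a set list \<Rightarrow> bool"
  where "direct_product H Gs \<longleftrightarrow> Gs \<noteq> [] \<and>
    (\<forall>G\<in>set Gs. normal_in H G (carrier H)) \<and>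
    (\<forall>i<length Gs. carrier H = (Gs ! i) \<odot>\<^bsub>H\<^esub> cofactor H Gs i \<and>
                   (Gs ! i) \<inter> cofactor H Gs i = {hid H})"

definition is_components ::
    "('a, 'b) hyperstructure_scheme \<Rightarrow> 'a set list \<Rightarrow> 'a \<Rightarrow> 'a list \<Rightarrow> bool"
  where "is_components H Gs a rs \<longleftrightarrow>
    list_all2 (\<in>) rs Gs \<and> a \<in> lprod H (map (\<lambda>r. {r}) rs)"

text \<open>Components exist uniquely in a direct product, see \<open>ex1_components\<close> below.\<close>

definition components :: "('a, 'b) hyperstructure_scheme \<Rightarrow> 'a set list \<Rightarrow> 'a \<Rightarrow> 'a list"
  where "components H Gs a = (THE rs. is_components H Gs a rs)"

definition support :: "('a, 'b) hyperstructure_scheme \<Rightarrow> 'a set list \<Rightarrow> 'a \<Rightarrow> 'a set"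
  where "support H Gs a = set (components H Gs a) - {hid H}"

definition constrained_direct_product ::
    "('a, 'b) hyperstructure_scheme \<Rightarrow> 'a set list \<Rightarrow> bool"
  where "constrained_direct_product H Gs \<longleftrightarrow> direct_product H Gs \<and>
    (\<forall>a\<in>carrier H. lprod H (map (\<lambda>r. {r}) (components H Gs a)) = {a})"

abbreviation factors :: "('a, 'b) hyperstructure_scheme \<Rightarrow> 'a list \<Rightarrow> 'a set list"
  where "factors H qs \<equiv> map (\<lambda>q. hgen H {q}) qs"

text \<open>The decomposition is part of the data, because supports depend on it.\<close>

definition elementary_abelian_2_hypergroup ::
    "('a, 'b) hyperstructure_scheme \<Rightarrow> 'a list \<Rightarrow> bool"
  where "elementary_abelian_2_hypergroup H qs \<longleftrightarrow> hypergroup H \<and>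
    (\<forall>q\<in>set qs. involution H q) \<and> constrained_direct_product H (factors H qs)"

definition Thick :: "('a, 'b) hyperstructure_scheme \<Rightarrow> 'a list \<Rightarrow> 'a set \<Rightarrow> 'a set"
  where "Thick H qs F =
    {a \<in> F. a = hid H \<or> (\<forall>b\<in>support H (factors H qs) a. thick H b)}"


section \<open>Well-definedness of components and of the group of thin elements\<close>

context hypergroup
begin

lemma is_hid: "is_hid H (hid H)"
  unfolding hid_def by (rule theI'[OF ex1_hid])

lemma hid_closed: "hid H \<in> carrier H"
  and hmult_hid_left: "a \<in> carrier H \<Longrightarrow> hmult H (hid H) a = {a}"
  and hmult_hid_right: "a \<in> carrier H \<Longrightarrow> hmult H a (hid H) = {a}"
  using is_hid unfolding is_hid_def by auto

lemma mem_cprod: "x \<in> F \<odot> G \<longleftrightarrow> (\<exists>b\<in>F. \<exists>c\<in>G. x \<in> hmult H b c)"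
  unfolding cprod_def by auto

lemma cprod_singletons: "{a} \<odot> {b} = hmult H a b"
  unfolding cprod_def by auto

lemma hmult_subset_cprod: "b \<in> F \<Longrightarrow> c \<in> G \<Longrightarrow> hmult H b c \<subseteq> F \<odot> G"
  unfolding cprod_def by auto

lemma cprod_mono: "F \<subseteq> F' \<Longrightarrow> G \<subseteq> G' \<Longrightarrow> F \<odot> G \<subseteq> F' \<odot> G'"
  unfolding cprod_def by blast

lemma cprod_closed: "F \<subseteq> carrier H \<Longrightarrow> G \<subseteq> carrier H \<Longrightarrow> F \<odot> G \<subseteq> carrier H"
  unfolding cprod_def using hmult_closed by blast

lemma cprod_assoc:
  assumes "F \<subseteq> carrier H" "G \<subseteq> carrier H" "K \<subseteq> carrier H"
  shows "(F \<odot> G) \<odot> K = F \<odot> (G \<odot> K)"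
proof -
  have "(F \<odot> G) \<odot> K = (\<Union>a\<in>F. \<Union>b\<in>G. \<Union>c\<in>K. hmult H a b \<odot> {c})"
    unfolding cprod_def by blast
  also have "\<dots> = (\<Union>a\<in>F. \<Union>b\<in>G. \<Union>c\<in>K. {a} \<odot> hmult H b c)"
    by (intro SUP_cong refl hassoc) (use assms in auto)
  also have "\<dots> = F \<odot> (G \<odot> K)"
    unfolding cprod_def by blast
  finally show ?thesis .
qed

lemma cprod_hid_left: "F \<subseteq> carrier H \<Longrightarrow> {hid H} \<odot> F = F"
  and cprod_hid_right: "F \<subseteq> carrier H \<Longrightarrow> F \<odot> {hid H} = F"
  unfolding cprod_def using hmult_hid_left hmult_hid_right by (auto simp: subset_iff)

lemma hid_mem_left: "a \<in> carrier H \<Longrightarrow> hid H \<in> hmult H (star H a) a"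
  using exchange2[of a a "hid H"] hmult_hid_right hid_closed by simp

lemma star_star: "a \<in> carrier H \<Longrightarrow> star H (star H a) = a"
  using exchange2[of "hid H" "star H a" a] hid_mem_left[of a] hmult_hid_right hid_closed
    star_closed by (metis singletonD)

lemma hid_mem_right: "a \<in> carrier H \<Longrightarrow> hid H \<in> hmult H a (star H a)"
  using hid_mem_left[of "star H a"] star_star star_closed by simp

lemma star_hid: "star H (hid H) = hid H"
  using hid_mem_left[OF hid_closed] hmult_hid_right star_closed hid_closed by (metis singletonD)

lemma eq_if_hid_mem:
  assumes "a \<in> carrier H" "b \<in> carrier H" "hid H \<in> hmult H (star H a) b"
  shows "a = b"
  using exchange2[of b a "hid H"] assms hmult_hid_right hid_closed by simp

lemma star_mult:
  assumes "x \<in> carrier H" "y \<in> carrier H" "z \<in> hmult H x y"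
  shows "star H z \<in> hmult H (star H y) (star H x)"
proof -
  have z: "z \<in> carrier H" using assms hmult_closed by blast
  have "x \<in> hmult H z (star H y)" using exchange1 assms z by blast
  then have "star H y \<in> hmult H (star H z) x"
    using exchange2[of x z "star H y"] assms z star_closed by blast
  then show ?thesis
    using exchange1[of "star H y" "star H z" x] assms z star_closed by blast
qed

lemma closed_subsetD:
  assumes "closed_subset H G"
  shows "G \<subseteq> carrier H" "hid H \<in> G" "x \<in> G \<Longrightarrow> star H x \<in> G"
    "x \<in> G \<Longrightarrow> y \<in> G \<Longrightarrow> hmult H x y \<subseteq> G"
proof -
  have G: "G \<subseteq> carrier H" "G \<noteq> {}" and GG: "(star H ` G) \<odot> G \<subseteq> G"
    using assms unfolding closed_subset_def by auto
  have P: "hmult H (star H x) y \<subseteq> G" if "x \<in> G" "y \<in> G" for x y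
    using hmult_subset_cprod[of "star H x" "star H ` G" y G] that GG by auto
  show "G \<subseteq> carrier H" by fact
  obtain x0 where x0: "x0 \<in> G" using G(2) by auto
  show e: "hid H \<in> G"
    using P[OF x0 x0] hid_mem_left[of x0] x0 G(1) by auto
  show s: "star H x \<in> G" if "x \<in> G" for x
    using P[OF that e] hmult_hid_right[of "star H x"] star_closed[of x] that G(1) by auto
  show "x \<in> G \<Longrightarrow> y \<in> G \<Longrightarrow> hmult H x y \<subseteq> G"
    using P[OF s[of x], of y] star_star[OF subsetD[OF G(1), of x]] by auto
qed

lemma closed_subsetI:
  assumes "G \<subseteq> carrier H" "hid H \<in> G" "\<And>x. x \<in> G \<Longrightarrow> star H x \<in> G"
    "\<And>x y. x \<in> G \<Longrightarrow> y \<in> G \<Longrightarrow> hmult H x y \<subseteq> G"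
  shows "closed_subset H G"
proof -
  have "(star H ` G) \<odot> G \<subseteq> G"
    unfolding cprod_def by (intro UN_least assms(4)) (auto intro: assms(3))
  then show ?thesis unfolding closed_subset_def using assms(1,2) by auto
qed

lemma normal_commute:
  assumes "normal_in H F (carrier H)" "X \<subseteq> carrier H"
  shows "F \<odot> X = X \<odot> F"
proof -
  have "F \<odot> X = (\<Union>a\<in>X. F \<odot> {a})" unfolding cprod_def by blast
  also have "\<dots> = (\<Union>a\<in>X. {a} \<odot> F)"
    using assms unfolding normal_in_def by (intro SUP_cong refl) blast
  also have "\<dots> = X \<odot> F" unfolding cprod_def by blast
  finally show ?thesis .
qed

lemma closed_carrier: "closed_subset H (carrier H)"
  by (rule closed_subsetI) (use hid_closed star_closed hmult_closed in auto)

lemma normal_hid: "normal_in H {hid H} (carrier H)"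
proof -
  have "closed_subset H {hid H}"
    by (rule closed_subsetI) (use hid_closed star_hid hmult_hid_left in auto)
  then show ?thesis
    unfolding normal_in_def using closed_carrier hid_closed
    by (simp add: cprod_hid_left cprod_hid_right)
qed

lemma normal_cprod:
  assumes F: "normal_in H F (carrier H)" and G: "normal_in H G (carrier H)"
  shows "normal_in H (F \<odot> G) (carrier H)"
proof -
  have cF: "closed_subset H F" and cG: "closed_subset H G"
    using F G unfolding normal_in_def by auto
  note dF = closed_subsetD[OF cF] and dG = closed_subsetD[OF cG]
  have sub: "F \<odot> G \<subseteq> carrier H" by (rule cprod_closed[OF dF(1) dG(1)])
  have FF: "F \<odot> F \<subseteq> F" and GG: "G \<odot> G \<subseteq> G"
    unfolding cprod_def by (intro UN_least dF(4) dG(4); assumption)+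
  have "(F \<odot> G) \<odot> (F \<odot> G) = F \<odot> (G \<odot> F) \<odot> G"
    using dF(1) dG(1) cprod_closed by (simp add: cprod_assoc)
  also have "G \<odot> F = F \<odot> G" using normal_commute[OF F dG(1)] by simp
  also have "F \<odot> (F \<odot> G) \<odot> G = (F \<odot> F) \<odot> (G \<odot> G)"
    using dF(1) dG(1) cprod_closed by (simp add: cprod_assoc)
  also have "\<dots> \<subseteq> F \<odot> G" by (intro cprod_mono FF GG)
  finally have mult: "(F \<odot> G) \<odot> (F \<odot> G) \<subseteq> F \<odot> G" .
  have "closed_subset H (F \<odot> G)"
  proof (rule closed_subsetI[OF sub])
    have "hid H \<in> hmult H (hid H) (hid H)" using hmult_hid_left hid_closed by simp
    then show "hid H \<in> F \<odot> G" unfolding mem_cprod using dF(2) dG(2) by blast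
    show "star H x \<in> F \<odot> G" if x: "x \<in> F \<odot> G" for x
    proof -
      obtain b c where bc: "b \<in> F" "c \<in> G" "x \<in> hmult H b c" using x unfolding mem_cprod by blast
      then have "star H x \<in> hmult H (star H c) (star H b)"
        using star_mult[OF _ _ bc(3)] bc(1,2) dF(1) dG(1) by auto
      then have "star H x \<in> G \<odot> F" unfolding mem_cprod using dF(3)[OF bc(1)] dG(3)[OF bc(2)] by blast
      then show ?thesis using normal_commute[OF F dG(1)] by simp
    qed
    show "hmult H x y \<subseteq> F \<odot> G" if "x \<in> F \<odot> G" "y \<in> F \<odot> G" for x y
      using hmult_subset_cprod[OF that] mult by (rule subset_trans)
  qed
  moreover have "F \<odot> G \<odot> {a} = {a} \<odot> (F \<odot> G)" if a: "a \<in> carrier H" for a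
  proof -
    have "F \<odot> G \<odot> {a} = F \<odot> (G \<odot> {a})" using a dF(1) dG(1) by (simp add: cprod_assoc)
    also have "\<dots> = F \<odot> ({a} \<odot> G)" using normal_commute[OF G, of "{a}"] a by simp
    also have "\<dots> = F \<odot> {a} \<odot> G" using a dF(1) dG(1) by (simp add: cprod_assoc)
    also have "\<dots> = {a} \<odot> F \<odot> G" using normal_commute[OF F, of "{a}"] a by simp
    also have "\<dots> = {a} \<odot> (F \<odot> G)" using a dF(1) dG(1) by (simp add: cprod_assoc)
    finally show ?thesis .
  qed
  ultimately show ?thesis unfolding normal_in_def using closed_carrier sub by simp
qed

lemma lprod_Nil: "lprod H [] = {hid H}"
  and lprod_Cons: "lprod H (G # Gs) = G \<odot> lprod H Gs"
  unfolding lprod_def by auto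

lemma lprod_closed: "(\<And>G. G \<in> set Gs \<Longrightarrow> G \<subseteq> carrier H) \<Longrightarrow> lprod H Gs \<subseteq> carrier H"
  by (induction Gs) (simp_all add: lprod_Nil lprod_Cons hid_closed cprod_closed)

lemma lprod_append:
  "(\<And>G. G \<in> set Fs \<union> set Gs \<Longrightarrow> G \<subseteq> carrier H) \<Longrightarrow> lprod H (Fs @ Gs) = lprod H Fs \<odot> lprod H Gs"
proof (induction Fs)
  case Nil
  then show ?case using lprod_closed[of Gs] by (simp add: lprod_Nil cprod_hid_left)
next
  case (Cons F Fs)
  have "F \<subseteq> carrier H" "lprod H Fs \<subseteq> carrier H" "lprod H Gs \<subseteq> carrier H"
    using Cons.prems lprod_closed[of Fs] lprod_closed[of Gs] by auto
  then show ?case using Cons by (simp add: lprod_Cons cprod_assoc)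
qed

lemma normal_lprod:
  "(\<And>G. G \<in> set Gs \<Longrightarrow> normal_in H G (carrier H)) \<Longrightarrow> normal_in H (lprod H Gs) (carrier H)"
  by (induction Gs) (simp_all add: lprod_Nil lprod_Cons normal_hid normal_cprod)

lemma lprod_singletons_subset:
  "list_all2 (\<in>) rs Gs \<Longrightarrow> lprod H (map (\<lambda>r. {r}) rs) \<subseteq> lprod H Gs"
  by (induction rule: list_all2_induct) (simp_all add: lprod_Nil lprod_Cons cprod_mono)

lemma lprod_components:
  "a \<in> lprod H Gs \<Longrightarrow> \<exists>rs. is_components H Gs a rs"
proof (induction Gs arbitrary: a)
  case Nil
  then show ?case by (auto simp: is_components_def lprod_Nil)
next
  case (Cons G Gs)
  then obtain r b where rb: "r \<in> G" "b \<in> lprod H Gs" "a \<in> hmult H r b"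
    by (auto simp: lprod_Cons mem_cprod)
  then obtain rs where "is_components H Gs b rs" using Cons.IH by blast
  then have "is_components H (G # Gs) a (r # rs)"
    using rb by (auto simp: is_components_def lprod_Cons mem_cprod)
  then show ?case by blast
qed

lemma component_cofactor:
  assumes n: "\<And>G. G \<in> set Gs \<Longrightarrow> normal_in H G (carrier H)"
    and c: "is_components H Gs a rs" and i: "i < length Gs"
  shows "a \<in> {rs ! i} \<odot> cofactor H Gs i"
proof -
  let ?S = "map (\<lambda>r. {r})"
  have sub: "G \<subseteq> carrier H" if "G \<in> set Gs" for G
    using n[OF that] unfolding normal_in_def by simp
  have l2: "list_all2 (\<in>) rs Gs" and a: "a \<in> lprod H (?S rs)"
    using c unfolding is_components_def by simp_all
  have len: "length rs = length Gs" using l2 by (rule list_all2_lengthD)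
  have rsub: "{r} \<subseteq> carrier H" if r: "r \<in> set rs" for r
  proof -
    obtain j where "j < length rs" "r = rs ! j" using r unfolding in_set_conv_nth by metis
    then have "r \<in> Gs ! j" "Gs ! j \<in> set Gs" using list_all2_nthD[OF l2, of j] len by simp_all
    then show ?thesis using sub[of "Gs ! j"] by auto
  qed
  let ?U = "lprod H (?S (take i rs))" and ?V = "lprod H (?S (drop (Suc i) rs))"
  let ?X = "lprod H (take i Gs)" and ?Y = "lprod H (drop (Suc i) Gs)"
  have split: "rs = take i rs @ rs ! i # drop (Suc i) rs"
    using i len by (simp add: id_take_nth_drop)
  have "lprod H (?S rs) = lprod H (?S (take i rs) @ ?S (rs ! i # drop (Suc i) rs))"
    by (subst split) simp
  also have "\<dots> = ?U \<odot> lprod H (?S (rs ! i # drop (Suc i) rs))"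
  proof (rule lprod_append)
    fix G assume "G \<in> set (?S (take i rs)) \<union> set (?S (rs ! i # drop (Suc i) rs))"
    then have "G \<in> set (?S (take i rs @ rs ! i # drop (Suc i) rs))" by simp
    then have "G \<in> set (?S rs)" using split by simp
    then show "G \<subseteq> carrier H" using rsub by auto
  qed
  finally have eq: "lprod H (?S rs) = ?U \<odot> ({rs ! i} \<odot> ?V)" by (simp add: lprod_Cons)
  have U: "?U \<subseteq> ?X" by (intro lprod_singletons_subset list_all2_takeI l2)
  have V: "?V \<subseteq> ?Y" by (intro lprod_singletons_subset list_all2_dropI l2)
  have X: "normal_in H ?X (carrier H)"
    by (rule normal_lprod) (erule n[OF in_set_takeD])
  have Xs: "?X \<subseteq> carrier H" using X unfolding normal_in_def by simp
  have Ys: "?Y \<subseteq> carrier H" by (rule lprod_closed) (erule sub[OF in_set_dropD])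
  have r: "{rs ! i} \<subseteq> carrier H" using rsub i len by simp
  have "a \<in> ?X \<odot> ({rs ! i} \<odot> ?Y)"
    using a cprod_mono[OF U cprod_mono[OF subset_refl V]] unfolding eq by (rule subsetD[rotated])
  also have "\<dots> = (?X \<odot> {rs ! i}) \<odot> ?Y" by (rule cprod_assoc[OF Xs r Ys, symmetric])
  also have "?X \<odot> {rs ! i} = {rs ! i} \<odot> ?X" by (rule normal_commute[OF X r])
  also have "({rs ! i} \<odot> ?X) \<odot> ?Y = {rs ! i} \<odot> (?X \<odot> ?Y)" by (rule cprod_assoc[OF r Xs Ys])
  also have "?X \<odot> ?Y = cofactor H Gs i"
    unfolding cofactor_def
  proof (rule lprod_append[symmetric])
    show "G \<subseteq> carrier H" if "G \<in> set (take i Gs) \<union> set (drop (Suc i) Gs)" for G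
      using that by (auto dest!: in_set_takeD in_set_dropD sub)
  qed
  finally show ?thesis .
qed

lemma normal_cofactor:
  assumes "\<And>G. G \<in> set Gs \<Longrightarrow> normal_in H G (carrier H)"
  shows "normal_in H (cofactor H Gs i) (carrier H)"
  unfolding cofactor_def using assms
  by (intro normal_lprod) (auto dest: in_set_dropD in_set_takeD)

lemma component_unique:
  assumes "closed_subset H G" "closed_subset H K" "G \<inter> K = {hid H}"
    and "r \<in> G" "s \<in> G" "a \<in> {r} \<odot> K" "a \<in> {s} \<odot> K"
  shows "r = s"
proof -
  note dG = closed_subsetD[OF assms(1)] and dK = closed_subsetD[OF assms(2)]
  obtain x y where x: "x \<in> K" "a \<in> hmult H r x" and y: "y \<in> K" "a \<in> hmult H s y"
    using assms(6,7) unfolding mem_cprod by blast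
  have c: "r \<in> carrier H" "s \<in> carrier H" "x \<in> carrier H" "y \<in> carrier H"
    using assms x y dG(1) dK(1) by auto
  have a: "a \<in> carrier H" using x c hmult_closed by blast
  have "r \<in> hmult H a (star H x)" using exchange1[OF a c(1,3)] x(2) by blast
  then have "r \<in> ({s} \<odot> {y}) \<odot> {star H x}" unfolding cprod_def using y by auto
  then have "r \<in> {s} \<odot> ({y} \<odot> {star H x})" using c star_closed by (simp add: cprod_assoc)
  then obtain w where w: "w \<in> hmult H y (star H x)" "r \<in> hmult H s w"
    unfolding cprod_def by auto
  have wK: "w \<in> K" using w(1) dK(4)[OF y(1) dK(3)[OF x(1)]] by blast
  then have "w \<in> hmult H (star H s) r" using exchange2[of r s w] w c dK(1) by blast
  then have "w \<in> G" using dG(4)[OF dG(3)[OF assms(5)] assms(4)] by blast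
  then have "w = hid H" using wK assms(3) by blast
  then show ?thesis using w c hmult_hid_right by simp
qed

lemma ex1_components:
  assumes d: "direct_product H Gs" and a: "a \<in> carrier H"
  shows "\<exists>!rs. is_components H Gs a rs"
proof (rule ex_ex1I)
  have n: "\<And>G. G \<in> set Gs \<Longrightarrow> normal_in H G (carrier H)"
    and "Gs \<noteq> []" and c0: "carrier H = (Gs ! 0) \<odot> cofactor H Gs 0"
    and int: "\<And>i. i < length Gs \<Longrightarrow> (Gs ! i) \<inter> cofactor H Gs i = {hid H}"
    using d unfolding direct_product_def by auto
  then have "carrier H = lprod H Gs"
    by (cases Gs) (auto simp: cofactor_def lprod_Cons)
  then show "\<exists>rs. is_components H Gs a rs" using lprod_components a by blast
  fix rs ss assume c: "is_components H Gs a rs" "is_components H Gs a ss"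
  then have len: "length rs = length Gs" "length ss = length Gs"
    and mem: "\<And>i. i < length Gs \<Longrightarrow> rs ! i \<in> Gs ! i" "\<And>i. i < length Gs \<Longrightarrow> ss ! i \<in> Gs ! i"
    unfolding is_components_def by (auto simp: list_all2_conv_all_nth)
  show "rs = ss"
  proof (rule nth_equalityI)
    fix i assume "i < length rs"
    then have i: "i < length Gs" using len by simp
    have "closed_subset H (Gs ! i)" "closed_subset H (cofactor H Gs i)"
      using n i normal_cofactor[of Gs i] unfolding normal_in_def by auto
    then show "rs ! i = ss ! i"
      by (rule component_unique)
        (use int i mem component_cofactor[OF n] c in auto)
  qed (use len in simp)
qed

lemma hmult_nonempty:
  assumes "a \<in> carrier H" "b \<in> carrier H"
  shows "hmult H a b \<noteq> {}"
proof -
  have "b \<in> ({star H a} \<odot> {a}) \<odot> {b}"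
    using assms hid_mem_left hmult_hid_left by (auto simp: cprod_def)
  then have "b \<in> {star H a} \<odot> hmult H a b"
    using assms star_closed by (simp add: cprod_assoc) (simp add: cprod_singletons)
  then show ?thesis unfolding cprod_def by auto
qed

lemma thin_mult:
  assumes a: "thin H a" and b: "thin H b"
  shows "\<exists>c. hmult H a b = {c} \<and> thin H c"
proof -
  have c: "a \<in> carrier H" "b \<in> carrier H" "star H a \<in> carrier H" "star H b \<in> carrier H"
    and t: "hmult H (star H a) a = {hid H}" "hmult H (star H b) b = {hid H}"
    using a b star_closed unfolding thin_def by auto
  have *: "hmult H (star H x) y = {hid H}" if x: "x \<in> hmult H a b" and y: "y \<in> hmult H a b" for x y
  proof -
    have xy: "x \<in> carrier H" "y \<in> carrier H" using x y c hmult_closed by blast+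
    have "star H x \<in> hmult H (star H b) (star H a)" using star_mult c x by blast
    then have "hmult H (star H x) y \<subseteq> ({star H b} \<odot> {star H a}) \<odot> ({a} \<odot> {b})"
      using y unfolding cprod_def by auto
    also have "\<dots> = {star H b} \<odot> (({star H a} \<odot> {a}) \<odot> {b})"
      using c cprod_closed by (simp add: cprod_assoc)
    also have "\<dots> = {hid H}"
      using c t by (simp add: cprod_singletons hmult_hid_left)
    finally show ?thesis using hmult_nonempty[of "star H x" y] xy star_closed by blast
  qed
  obtain x where x: "x \<in> hmult H a b" using hmult_nonempty c by blast
  have xc: "x \<in> carrier H" using x c hmult_closed by blast
  have "y = x" if y: "y \<in> hmult H a b" for y
  proof -
    have yc: "y \<in> carrier H" using y c hmult_closed by blast
    have "hid H \<in> hmult H (star H x) y" using *[OF x y] by simp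
    then show ?thesis using eq_if_hid_mem[OF xc yc] by simp
  qed
  then have "hmult H a b = {x}" using x by blast
  moreover have "thin H x" unfolding thin_def using xc *[OF x x] by simp
  ultimately show ?thesis by blast
qed

lemma hgen_involution:
  assumes "involution H q"
  shows "hgen H {q} = {hid H, q}"
proof
  have "closed_subset H {hid H, q}" using assms unfolding involution_def by blast
  then show "hgen H {q} \<subseteq> {hid H, q}" unfolding hgen_def by (intro Inter_lower) simp
  show "{hid H, q} \<subseteq> hgen H {q}" unfolding hgen_def
    by (rule Inter_greatest) (simp add: closed_subsetD(2))
qed

lemma star_involution:
  assumes "involution H q"
  shows "star H q = q"
proof (rule ccontr)
  assume "star H q \<noteq> q"
  moreover have q: "q \<in> carrier H" "q \<noteq> hid H" "closed_subset H {hid H, q}"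
    using assms unfolding involution_def by auto
  ultimately have "star H q = hid H" using closed_subsetD(3)[OF q(3), of q] by simp
  then show False using star_star[OF q(1)] star_hid q(2) by simp
qed

lemma star_elementary:
  assumes E: "elementary_abelian_2_hypergroup H qs" and a: "a \<in> carrier H"
  shows "star H a = a"
proof -
  let ?Gs = "factors H qs"
  have d: "direct_product H ?Gs" and inv: "\<And>q. q \<in> set qs \<Longrightarrow> involution H q"
    and con: "\<And>b. b \<in> carrier H \<Longrightarrow> lprod H (map (\<lambda>r. {r}) (components H ?Gs b)) = {b}"
    using E unfolding elementary_abelian_2_hypergroup_def constrained_direct_product_def by auto
  have n: "\<And>G. G \<in> set ?Gs \<Longrightarrow> normal_in H G (carrier H)"
    and int: "\<And>i. i < length ?Gs \<Longrightarrow> (?Gs ! i) \<inter> cofactor H ?Gs i = {hid H}"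
    using d unfolding direct_product_def by auto
  have comp: "is_components H ?Gs b (components H ?Gs b)" if "b \<in> carrier H" for b
    unfolding components_def by (rule theI'[OF ex1_components[OF d that]])
  let ?r = "components H ?Gs a" and ?s = "components H ?Gs (star H a)"
  note cr = comp[OF a] and cs = comp[OF star_closed[OF a]]
  have len: "length ?r = length ?Gs" "length ?s = length ?Gs"
    and mem: "\<And>i. i < length ?Gs \<Longrightarrow> ?r ! i \<in> ?Gs ! i" "\<And>i. i < length ?Gs \<Longrightarrow> ?s ! i \<in> ?Gs ! i"
    using cr cs unfolding is_components_def by (auto simp: list_all2_conv_all_nth)
  have "?r = ?s"
  proof (rule nth_equalityI)
    fix i assume "i < length ?r"
    then have i: "i < length ?Gs" using len by simp
    let ?K = "cofactor H ?Gs i" and ?si = "?s ! i"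
    have K: "normal_in H ?K (carrier H)" by (rule normal_cofactor[OF n])
    then have cK: "closed_subset H ?K" unfolding normal_in_def by blast
    have cG: "closed_subset H (?Gs ! i)" using n[OF nth_mem[OF i]] unfolding normal_in_def by blast
    have sic: "?si \<in> carrier H" using mem(2)[OF i] closed_subsetD(1)[OF cG] by blast
    have "star H ?si = ?si"
    proof -
      have q: "involution H (qs ! i)" using i inv by simp
      then have "?si = hid H \<or> ?si = qs ! i" using mem(2)[OF i] i hgen_involution[OF q] by simp
      then show ?thesis using star_involution[OF q] star_hid by (elim disjE) simp_all
    qed
    obtain x where x: "x \<in> ?K" "star H a \<in> hmult H ?si x"
      using component_cofactor[OF n cs i] unfolding mem_cprod by auto
    have xc: "x \<in> carrier H" using closed_subsetD(1)[OF cK] x(1) by (rule subsetD)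
    have "star H (star H a) \<in> hmult H (star H x) (star H ?si)"
      by (rule star_mult[OF sic xc x(2)])
    then have "a \<in> ?K \<odot> {?si}"
      using \<open>star H ?si = ?si\<close> star_star[OF a] closed_subsetD(3)[OF cK x(1)]
      by (auto simp: mem_cprod)
    then have as: "a \<in> {?si} \<odot> ?K" using normal_commute[OF K, of "{?si}"] sic by simp
    have ar: "a \<in> {?r ! i} \<odot> ?K" by (rule component_cofactor[OF n cr i])
    show "?r ! i = ?si"
      by (rule component_unique[OF cG cK int[OF i] mem[OF i] ar as])
  qed (use len in simp)
  from this con[OF a] have "lprod H (map (\<lambda>r. {r}) ?s) = {a}" by (rule subst)
  from con[OF star_closed[OF a], symmetric] this have "{star H a} = {a}" by (rule trans)
  then show ?thesis by (rule singleton_inject)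
qed

lemma comm_group_thin_group:
  assumes E: "elementary_abelian_2_hypergroup H qs"
  shows "comm_group (thin_group H)"
    and "X \<in> carrier (thin_group H) \<Longrightarrow> X \<otimes>\<^bsub>thin_group H\<^esub> X = \<one>\<^bsub>thin_group H\<^esub>"
proof -
  let ?T = "thin_group H"
  have carr: "X \<in> carrier ?T \<longleftrightarrow> (\<exists>a. X = {a} \<and> thin H a)" for X
    unfolding thin_group_def singletons_def thin_part_def thin_def by auto
  have sq: "X \<otimes>\<^bsub>?T\<^esub> X = \<one>\<^bsub>?T\<^esub>" if "X \<in> carrier ?T" for X
    using that star_elementary[OF E] unfolding carr
    by (auto simp: thin_group_def cprod_singletons thin_def)
  have sub: "X \<subseteq> carrier H" if "X \<in> carrier ?T" for X
    using that unfolding carr by (auto simp: thin_def)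
  have one: "\<one>\<^bsub>?T\<^esub> \<in> carrier ?T"
    unfolding carr using hid_closed star_hid hmult_hid_left
    by (auto simp: thin_group_def thin_def)
  interpret group ?T
  proof (rule groupI)
    fix X Y Z assume X: "X \<in> carrier ?T" and Y: "Y \<in> carrier ?T"
    show "X \<otimes>\<^bsub>?T\<^esub> Y \<in> carrier ?T"
      using X Y thin_mult unfolding carr by (force simp: thin_group_def cprod_singletons)
    show "X \<otimes>\<^bsub>?T\<^esub> Y \<otimes>\<^bsub>?T\<^esub> Z = X \<otimes>\<^bsub>?T\<^esub> (Y \<otimes>\<^bsub>?T\<^esub> Z)" if "Z \<in> carrier ?T"
      using cprod_assoc[OF sub[OF X] sub[OF Y] sub[OF that]] by (simp add: thin_group_def)
  next
    fix X assume X: "X \<in> carrier ?T"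
    show "\<one>\<^bsub>?T\<^esub> \<otimes>\<^bsub>?T\<^esub> X = X"
      using cprod_hid_left[OF sub[OF X]] by (simp add: thin_group_def)
    show "\<exists>Y\<in>carrier ?T. Y \<otimes>\<^bsub>?T\<^esub> X = \<one>\<^bsub>?T\<^esub>" using sq X by blast
  qed (rule one)
  show "comm_group ?T"
  proof (rule group_comm_groupI)
    fix X Y assume XY: "X \<in> carrier ?T" "Y \<in> carrier ?T"
    have i: "inv\<^bsub>?T\<^esub> Z = Z" if "Z \<in> carrier ?T" for Z
      using inv_equality[OF sq[OF that] that that] .
    have "X \<otimes>\<^bsub>?T\<^esub> Y = inv\<^bsub>?T\<^esub> (X \<otimes>\<^bsub>?T\<^esub> Y)"
      using i[OF m_closed[OF XY]] by (rule sym)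
    also have "\<dots> = inv\<^bsub>?T\<^esub> Y \<otimes>\<^bsub>?T\<^esub> inv\<^bsub>?T\<^esub> X" by (rule inv_mult_group[OF XY])
    also have "\<dots> = Y \<otimes>\<^bsub>?T\<^esub> X" unfolding i[OF XY(1)] i[OF XY(2)] ..
    finally show "X \<otimes>\<^bsub>?T\<^esub> Y = Y \<otimes>\<^bsub>?T\<^esub> X" .
  qed
  show "X \<in> carrier ?T \<Longrightarrow> X \<otimes>\<^bsub>?T\<^esub> X = \<one>\<^bsub>?T\<^esub>" by (rule sq)
qed

end

end

theory Submission
  imports Defs
begin

text \<open>An element of an elementary abelian 2-hypergroup is determined by the set of indices at which
  its component is an involution. In these coordinates the product of \<open>S\<close> and \<open>T\<close> consists of all
  sets between the symmetric difference of \<open>S\<close> and \<open>T\<close> and its union with \<open>S \<inter> T \<inter> K\<close>, where \<open>K\<close>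
  is the set of indices of thick involutions. Hence a closed subset contains, with every \<open>S\<close>, all
  subsets of \<open>S \<inter> K\<close>, and it is closed under unions of subsets of \<open>K\<close>. The largest subset of \<open>K\<close>
  in it generates its thin residue, and the sets disjoint from \<open>K\<close> form a complement.\<close>

context hypergroup
begin

section \<open>Commutativity and generated closed subsets\<close>

text \<open>The star map reverses products by \<open>star_mult\<close>, so a trivial star map forces
  commutativity.\<close>

lemma hmult_commute:
  assumes "\<And>a. a \<in> carrier H \<Longrightarrow> star H a = a" "a \<in> carrier H" "b \<in> carrier H"
  shows "hmult H a b = hmult H b a"
proof -
  have "z \<in> hmult H y x" if "z \<in> hmult H x y" "x \<in> carrier H" "y \<in> carrier H" for x y z
    using star_mult[OF that(2,3,1)] assms(1) that hmult_closed[OF that(2,3)] by auto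
  then show ?thesis using assms(2,3) by blast
qed

lemma cprod_commute:
  assumes "\<And>a. a \<in> carrier H \<Longrightarrow> star H a = a" "F \<subseteq> carrier H" "G \<subseteq> carrier H"
  shows "F \<odot> G = G \<odot> F"
  using hmult_commute[OF assms(1)] assms(2,3) unfolding cprod_def by blast

text \<open>Makes \<open>normal_cprod\<close> applicable to arbitrary closed subsets, so that their
  products are closed again.\<close>

lemma closed_normal_in_carrier:
  assumes "\<And>a. a \<in> carrier H \<Longrightarrow> star H a = a" "closed_subset H F"
  shows "normal_in H F (carrier H)"
  unfolding normal_in_def
  using assms closed_carrier closed_subsetD(1)[OF assms(2)] cprod_commute[OF assms(1)] by simp

lemma hgen_subset: "closed_subset H F \<Longrightarrow> X \<subseteq> F \<Longrightarrow> hgen H X \<subseteq> F"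
  unfolding hgen_def by blast

lemma subset_hgen: "X \<subseteq> hgen H X"
  unfolding hgen_def by blast

lemma closed_hgen:
  assumes "X \<subseteq> carrier H"
  shows "closed_subset H (hgen H X)"
proof (rule closed_subsetI)
  show "hgen H X \<subseteq> carrier H" by (rule hgen_subset[OF closed_carrier assms])
  show "hid H \<in> hgen H X"
    unfolding hgen_def using closed_subsetD(2) by simp
  show "star H x \<in> hgen H X" if "x \<in> hgen H X" for x
    using that closed_subsetD(3) unfolding hgen_def by simp
  show "hmult H x y \<subseteq> hgen H X" if "x \<in> hgen H X" "y \<in> hgen H X" for x y
    unfolding hgen_def
    by (intro Inter_greatest closed_subsetD(4)) (use that in \<open>auto simp: hgen_def\<close>)
qed

lemma hgen_closed: "closed_subset H F \<Longrightarrow> hgen H F = F"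
  by (simp add: hgen_subset subset_hgen subset_antisym)

lemma closed_cprod_subset:
  assumes "closed_subset H G" "A \<subseteq> G" "B \<subseteq> G"
  shows "A \<odot> B \<subseteq> G"
  unfolding cprod_def
  by (intro UN_least closed_subsetD(4)[OF assms(1)]) (use assms(2,3) in auto)

section \<open>Componentwise multiplication in products of lists\<close>

lemma cprod_interchange:
  assumes "\<And>a. a \<in> carrier H \<Longrightarrow> star H a = a"
    and "A \<subseteq> carrier H" "B \<subseteq> carrier H" "C \<subseteq> carrier H" "D \<subseteq> carrier H"
  shows "(A \<odot> B) \<odot> (C \<odot> D) = (A \<odot> C) \<odot> (B \<odot> D)"
proof -
  have "(A \<odot> B) \<odot> (C \<odot> D) = A \<odot> ((B \<odot> C) \<odot> D)"
    using assms by (simp add: cprod_assoc cprod_closed)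
  also have "B \<odot> C = C \<odot> B" by (rule cprod_commute[OF assms(1,3,4)])
  also have "A \<odot> ((C \<odot> B) \<odot> D) = (A \<odot> C) \<odot> (B \<odot> D)"
    using assms by (simp add: cprod_assoc cprod_closed)
  finally show ?thesis .
qed

text \<open>Reduces multiplication in a direct product to its factors. The interchange law brings
  the heads of both lists together, and induction handles the tails.\<close>

lemma lprod_cprod:
  assumes st: "\<And>a. a \<in> carrier H \<Longrightarrow> star H a = a"
    and "\<And>x. x \<in> set xs \<Longrightarrow> f x \<subseteq> carrier H" "\<And>x. x \<in> set xs \<Longrightarrow> g x \<subseteq> carrier H"
  shows "lprod H (map f xs) \<odot> lprod H (map g xs) = lprod H (map (\<lambda>x. f x \<odot> g x) xs)"
  using assms(2,3)
proof (induction xs)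
  case Nil
  then show ?case by (simp add: lprod_Nil cprod_hid_left hid_closed)
next
  case (Cons x xs)
  have "lprod H (map f xs) \<subseteq> carrier H" "lprod H (map g xs) \<subseteq> carrier H"
    by (rule lprod_closed; use Cons.prems in auto)+
  then show ?case
    using Cons cprod_interchange[OF st] by (simp add: lprod_Cons)
qed

lemma lprod_singletons_closed:
  "set rs \<subseteq> carrier H \<Longrightarrow> lprod H (map (\<lambda>r. {r}) rs) \<subseteq> carrier H"
  by (rule lprod_closed) auto

text \<open>Provides elements with prescribed components, hence surjectivity of the coordinate
  map.\<close>

lemma lprod_singletons_nonempty:
  "set rs \<subseteq> carrier H \<Longrightarrow> lprod H (map (\<lambda>r. {r}) rs) \<noteq> {}"
proof (induction rs)
  case Nil
  then show ?case by (simp add: lprod_Nil)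
next
  case (Cons r rs)
  then obtain b where b: "b \<in> lprod H (map (\<lambda>r. {r}) rs)" by auto
  have "lprod H (map (\<lambda>r. {r}) rs) \<subseteq> carrier H"
    by (rule lprod_singletons_closed) (use Cons.prems in simp)
  with b have "hmult H r b \<noteq> {}" using hmult_nonempty Cons.prems by auto
  then show ?case using b by (auto simp: lprod_Cons cprod_def)
qed

text \<open>Closedness of \<open>{hid H, q}\<close> leaves two candidates for the product. As
  \<open>q\<close> is its own star, the identity always occurs, and \<open>q\<close> occurs exactly
  when \<open>q\<close> is thick.\<close>

lemma hmult_involution:
  assumes "involution H q"
  shows "hmult H q q = (if thick H q then {hid H, q} else {hid H})"
proof -
  have q: "q \<in> carrier H" "closed_subset H {hid H, q}"
    using assms unfolding involution_def by auto
  have s: "star H q = q" by (rule star_involution[OF assms])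
  have "hmult H q q \<subseteq> {hid H, q}" using closed_subsetD(4)[OF q(2), of q q] by simp
  moreover have "hid H \<in> hmult H q q" using hid_mem_left[OF q(1)] s by simp
  ultimately show ?thesis unfolding thick_def thin_def s using q(1) by auto
qed

end

section \<open>Hypergroups in set coordinates\<close>

text \<open>The locale hides involutions and component lists, so that closed subsets can be studied
  by finite set algebra alone. Finiteness of \<open>N\<close> serves to choose a maximal subset of
  \<open>K\<close>.\<close>

locale set_coordinates = hypergroup +
  fixes S :: "'a \<Rightarrow> 'i set" and N K :: "'i set"
  assumes finite_N: "finite N"
    and star_eq: "a \<in> carrier H \<Longrightarrow> star H a = a"
    and bij_S: "bij_betw S (carrier H) (Pow N)"
    and mem_hmult: "a \<in> carrier H \<Longrightarrow> b \<in> carrier H \<Longrightarrow> c \<in> hmult H a b \<longleftrightarrow> c \<in> carrier H \<and>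
      (S a - S b) \<union> (S b - S a) \<subseteq> S c \<and> S c \<subseteq> (S a - S b) \<union> (S b - S a) \<union> (S a \<inter> S b \<inter> K)"
begin

lemma S_inj: "a \<in> carrier H \<Longrightarrow> b \<in> carrier H \<Longrightarrow> S a = S b \<Longrightarrow> a = b"
  using bij_S unfolding bij_betw_def inj_on_def by blast

lemma S_subset: "a \<in> carrier H \<Longrightarrow> S a \<subseteq> N"
  using bij_S unfolding bij_betw_def by blast

lemma S_surj:
  assumes "U \<subseteq> N"
  obtains a where "a \<in> carrier H" "S a = U"
  using bij_S assms unfolding bij_betw_def by (metis PowI imageE)

lemma S_hid [simp]: "S (hid H) = {}"
proof -
  obtain z where z: "z \<in> carrier H" "S z = {}" using S_surj[of "{}"] by auto
  have "z \<in> hmult H (hid H) (hid H)" unfolding mem_hmult[OF hid_closed hid_closed] using z by simp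
  then show ?thesis using hmult_hid_left hid_closed z by simp
qed

lemma S_eq_empty: "a \<in> carrier H \<Longrightarrow> S a = {} \<longleftrightarrow> a = hid H"
  using S_inj[of a "hid H"] hid_closed by auto

text \<open>Since \<open>a\<close> is its own star, thinness concerns the product of
  \<open>a\<close> with itself, which consists of all elements with coordinates inside
  \<open>S a \<inter> K\<close>.\<close>

lemma thin_iff: "thin H a \<longleftrightarrow> a \<in> carrier H \<and> S a \<inter> K = {}"
proof (cases "a \<in> carrier H")
  case a: True
  show ?thesis
  proof
    assume t: "thin H a"
    obtain b where b: "b \<in> carrier H" "S b = S a \<inter> K"
      using S_surj[of "S a \<inter> K"] S_subset[OF a] by auto
    then have "b \<in> hmult H a a" using mem_hmult a by auto
    then have "b = hid H" using t star_eq a unfolding thin_def by auto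
    then show "a \<in> carrier H \<and> S a \<inter> K = {}" using a b by auto
  next
    assume "a \<in> carrier H \<and> S a \<inter> K = {}"
    then have "hmult H a a = {hid H}"
      using mem_hmult[of a a] S_eq_empty hid_closed by auto
    then show "thin H a" unfolding thin_def using a star_eq by simp
  qed
qed (simp add: thin_def)

text \<open>The right-hand side is closed because products stay within the union of the coordinate
  sets. It is generated by \<open>r\<close> because \<open>S r \<subseteq> K\<close> makes it the
  product of \<open>r\<close> with itself.\<close>

lemma hgen_thick_element:
  assumes r: "r \<in> carrier H" "S r \<subseteq> K"
  shows "hgen H {r} = {a \<in> carrier H. S a \<subseteq> S r}"
proof
  have "closed_subset H {a \<in> carrier H. S a \<subseteq> S r}"
  proof (rule closed_subsetI)
    show "hmult H x y \<subseteq> {a \<in> carrier H. S a \<subseteq> S r}"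
      if "x \<in> {a \<in> carrier H. S a \<subseteq> S r}" "y \<in> {a \<in> carrier H. S a \<subseteq> S r}" for x y
    proof -
      have xy: "x \<in> carrier H" "y \<in> carrier H" "S x \<subseteq> S r" "S y \<subseteq> S r" using that by simp_all
      then show ?thesis using mem_hmult[OF xy(1,2)] by (intro subsetI) auto
    qed
  qed (use hid_closed star_eq in auto)
  then show "hgen H {r} \<subseteq> {a \<in> carrier H. S a \<subseteq> S r}"
    by (rule hgen_subset) (use r in simp)
  have "{a \<in> carrier H. S a \<subseteq> S r} \<subseteq> hmult H r r" using mem_hmult r by auto
  also have "\<dots> \<subseteq> hgen H {r}"
    using closed_subsetD(4)[OF closed_hgen[of "{r}"]] subset_hgen[of "{r}"] r by auto
  finally show "{a \<in> carrier H. S a \<subseteq> S r} \<subseteq> hgen H {r}" .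
qed

section \<open>Thin residue and thin complement of a closed subset\<close>

text \<open>Every such \<open>b\<close> already lies in the product of \<open>a\<close> with
  itself.\<close>

lemma closed_mem_if_subset_thick:
  assumes "closed_subset H G" "a \<in> G" "b \<in> carrier H" "S b \<subseteq> S a \<inter> K"
  shows "b \<in> G"
proof -
  have a: "a \<in> carrier H" using assms(2) closed_subsetD(1)[OF assms(1)] by (rule subsetD[rotated])
  have "b \<in> hmult H a a" unfolding mem_hmult[OF a a] using assms(3,4) by simp
  then show ?thesis using closed_subsetD(4)[OF assms(1,2,2)] by blast
qed

text \<open>A maximal \<open>S r\<close> exists by finiteness. It is the largest one, since joining
  it with the thick part of any other element stays in \<open>G\<close>.\<close>

lemma closed_obtain_largest_thick:
  assumes G: "closed_subset H G"
  obtains r where "r \<in> G" "S r \<subseteq> K" "\<And>a. a \<in> G \<Longrightarrow> S a \<inter> K \<subseteq> S r"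
proof -
  note dG = closed_subsetD[OF G]
  let ?A = "{a \<in> G. S a \<subseteq> K}"
  have "finite (S ` ?A)"
    by (rule finite_subset[of _ "Pow N"]) (use dG(1) S_subset finite_N in auto)
  moreover have "S ` ?A \<noteq> {}" using dG(2) by auto
  ultimately have "\<exists>R\<in>S ` ?A. \<forall>U\<in>S ` ?A. R \<subseteq> U \<longrightarrow> R = U"
    by (rule finite_has_maximal)
  then obtain r where r: "r \<in> G" "S r \<subseteq> K" and R: "\<forall>U\<in>S ` ?A. S r \<subseteq> U \<longrightarrow> S r = U"
    by blast
  have "S a \<inter> K \<subseteq> S r" if a: "a \<in> G" for a
  proof -
    have c: "a \<in> carrier H" "r \<in> carrier H" using a r dG(1) by auto
    obtain b where b: "b \<in> carrier H" "S b = S a \<inter> K"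
      using S_surj[of "S a \<inter> K"] S_subset[OF c(1)] by auto
    then have bG: "b \<in> G" using closed_mem_if_subset_thick[OF G a] by simp
    \<comment> \<open>Both \<open>S r\<close> and \<open>S b\<close> lie in \<open>K\<close>, so
      their full union is the upper bound for the product of \<open>r\<close> and \<open>b\<close>,
      and it is attained by \<open>u\<close>.\<close>
    obtain u where u: "u \<in> carrier H" "S u = S r \<union> S b"
      using S_surj[of "S r \<union> S b"] S_subset c b(1) by auto
    have "u \<in> hmult H r b" unfolding mem_hmult[OF c(2) b(1)] using u b(2) r(2) by auto
    then have "u \<in> G" using dG(4)[OF r(1) bG] by blast
    moreover have "S u \<subseteq> K" "S r \<subseteq> S u" using u(2) b(2) r(2) by auto
    ultimately have "S r = S u" using R by simp
    then show ?thesis using u(2) b(2) by auto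
  qed
  then show ?thesis using that r by blast
qed

text \<open>By commutativity, conjugating the closed subset generated by \<open>r\<close> with
  \<open>a\<close> multiplies it by the product of \<open>a\<close> with itself, which it contains
  by \<open>max\<close>. Conversely, a strongly normal closed subset contains the conjugate of the
  identity by \<open>r\<close>, and \<open>r\<close> lies in it because
  \<open>S r \<subseteq> K\<close>.\<close>

lemma thin_residue_closed:
  assumes G: "closed_subset H G" and r: "r \<in> G" "S r \<subseteq> K"
    and max: "\<And>a. a \<in> G \<Longrightarrow> S a \<inter> K \<subseteq> S r"
  shows "thin_residue H G = hgen H {r}"
proof
  note dG = closed_subsetD[OF G]
  have rc: "r \<in> carrier H" using r dG(1) by auto
  note gen = hgen_thick_element[OF rc r(2)]
  have cR: "closed_subset H (hgen H {r})" using closed_hgen rc by simp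
  note dR = closed_subsetD[OF cR]
  have "strongly_normal_in H (hgen H {r}) G"
    unfolding strongly_normal_in_def
  proof (intro conjI cR G ballI)
    show "hgen H {r} \<subseteq> G" by (rule hgen_subset[OF G]) (use r in simp)
    fix a assume a: "a \<in> G"
    then have ac: "a \<in> carrier H" using dG(1) by auto
    have "{star H a} \<odot> hgen H {r} \<odot> {a} = hgen H {r} \<odot> {a} \<odot> {a}"
      using star_eq[OF ac] cprod_commute[OF star_eq, of "{a}" "hgen H {r}"] ac dR(1) by simp
    also have "\<dots> = hgen H {r} \<odot> hmult H a a"
      using ac dR(1) by (simp add: cprod_assoc cprod_singletons)
    also have "\<dots> \<subseteq> hgen H {r} \<odot> hgen H {r}"
      by (rule cprod_mono) (use mem_hmult[OF ac ac] max[OF a] gen in auto)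
    also have "\<dots> \<subseteq> hgen H {r}" by (rule closed_cprod_subset[OF cR]) simp_all
    finally show "{star H a} \<odot> hgen H {r} \<odot> {a} \<subseteq> hgen H {r}" .
  qed
  then show "thin_residue H G \<subseteq> hgen H {r}"
    unfolding thin_residue_def hgen_closed[OF G] by blast
  show "hgen H {r} \<subseteq> thin_residue H G"
    unfolding thin_residue_def hgen_closed[OF G]
  proof (rule Inter_greatest)
    fix F assume "F \<in> {F. strongly_normal_in H F G}"
    then have F: "closed_subset H F" and n: "{star H r} \<odot> F \<odot> {r} \<subseteq> F"
      using r(1) unfolding strongly_normal_in_def by auto
    have "r \<in> hmult H r r" using mem_hmult[OF rc rc] rc r by auto
    also have "hmult H r r = {star H r} \<odot> {hid H} \<odot> {r}"
      using rc star_eq hmult_hid_right by (simp add: cprod_singletons)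
    also have "\<dots> \<subseteq> {star H r} \<odot> F \<odot> {r}"
      by (intro cprod_mono subset_refl) (use closed_subsetD(2)[OF F] in simp)
    finally show "hgen H {r} \<subseteq> F" using n by (intro hgen_subset F) auto
  qed
qed

text \<open>Each \<open>a\<close> splits into a thick part \<open>u\<close> and a thin part
  \<open>t\<close>. Their coordinate sets are disjoint with union \<open>S a\<close>, so their
  product contains \<open>a\<close>.\<close>

lemma closed_decomposition:
  assumes G: "closed_subset H G" and r: "r \<in> G" "S r \<subseteq> K"
    and max: "\<And>a. a \<in> G \<Longrightarrow> S a \<inter> K \<subseteq> S r"
  shows "G = hgen H {r} \<odot> thin_part H G"
proof
  note dG = closed_subsetD[OF G]
  have rc: "r \<in> carrier H" using r dG(1) by auto
  note gen = hgen_thick_element[OF rc r(2)]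
  show "hgen H {r} \<odot> thin_part H G \<subseteq> G"
  proof -
    have "hgen H {r} \<subseteq> G" by (rule hgen_subset[OF G]) (use r in simp)
    then show ?thesis by (rule closed_cprod_subset[OF G]) (auto simp: thin_part_def)
  qed
  show "G \<subseteq> hgen H {r} \<odot> thin_part H G"
  proof
    fix a assume a: "a \<in> G"
    then have ac: "a \<in> carrier H" using dG(1) by auto
    obtain u where u: "u \<in> carrier H" "S u = S a \<inter> K"
      using S_surj[of "S a \<inter> K"] S_subset[OF ac] by auto
    obtain t where t: "t \<in> carrier H" "S t = S a - K"
      using S_surj[of "S a - K"] S_subset[OF ac] by auto
    have uG: "u \<in> G" using closed_mem_if_subset_thick[OF G a u(1)] u(2) by simp
    \<comment> \<open>The symmetric difference of \<open>S a\<close> and \<open>S u\<close> is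
      \<open>S a - K\<close>, so \<open>t\<close> has the smallest coordinate set in this
      product.\<close>
    have "t \<in> hmult H a u" unfolding mem_hmult[OF ac u(1)] using t u by auto
    then have "t \<in> G" using dG(4)[OF a uG] by blast
    then have "t \<in> thin_part H G" unfolding thin_part_def thin_iff using t by auto
    moreover have "u \<in> hgen H {r}" using gen u max[OF a] by auto
    moreover have "a \<in> hmult H u t" unfolding mem_hmult[OF u(1) t(1)] using ac t u by auto
    ultimately show "a \<in> hgen H {r} \<odot> thin_part H G" unfolding mem_cprod by blast
  qed
qed

lemma hgen_Int_thin_part:
  assumes "closed_subset H G" "r \<in> carrier H" "S r \<subseteq> K"
  shows "hgen H {r} \<inter> thin_part H G = {hid H}"
proof
  show "{hid H} \<subseteq> hgen H {r} \<inter> thin_part H G"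
    unfolding hgen_thick_element[OF assms(2,3)] thin_part_def thin_iff
    using closed_subsetD(2)[OF assms(1)] hid_closed by simp
  show "hgen H {r} \<inter> thin_part H G \<subseteq> {hid H}"
  proof
    fix x assume "x \<in> hgen H {r} \<inter> thin_part H G"
    then have x: "x \<in> carrier H" "S x \<subseteq> S r" "S x \<inter> K = {}"
      unfolding hgen_thick_element[OF assms(2,3)] thin_part_def thin_iff by simp_all
    then have "S x = {}" using assms(3) by blast
    then show "x \<in> {hid H}" using S_eq_empty[OF x(1)] by simp
  qed
qed

end

section \<open>Set coordinates of an elementary abelian 2-hypergroup\<close>

text \<open>Products are computed componentwise, and each factor has only two elements, so its
  multiplication table depends only on whether its involution is thick.\<close>

lemma elementary_abelian_2_hypergroup_coordinates:
  assumes E: "elementary_abelian_2_hypergroup H qs"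
  defines "c \<equiv> components H (factors H qs)"
  defines "S \<equiv> \<lambda>a. {i. i < length qs \<and> c a ! i \<noteq> hid H}"
    and "K \<equiv> {i. i < length qs \<and> thick H (qs ! i)}"
  shows "set_coordinates H S {..<length qs} K"
    and "a \<in> carrier H \<Longrightarrow> support H (factors H qs) a = (!) qs ` S a"
proof -
  interpret hypergroup H using E unfolding elementary_abelian_2_hypergroup_def by blast
  note st = star_elementary[OF E]
  let ?Gs = "factors H qs" and ?n = "length qs" and ?P = "\<lambda>rs. lprod H (map (\<lambda>r. {r}) rs)"
  have d: "direct_product H ?Gs" and inv: "\<And>i. i < ?n \<Longrightarrow> involution H (qs ! i)"
    and con: "\<And>b. b \<in> carrier H \<Longrightarrow> ?P (c b) = {b}"
    using E unfolding elementary_abelian_2_hypergroup_def constrained_direct_product_def c_def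
    by auto
  have comps: "is_components H ?Gs b rs \<longleftrightarrow> length rs = ?n \<and>
      (\<forall>i<?n. rs ! i \<in> {hid H, qs ! i}) \<and> b \<in> ?P rs" for b rs
    unfolding is_components_def list_all2_conv_all_nth using inv by (auto simp: hgen_involution)
  have q: "qs ! i \<in> carrier H" "qs ! i \<noteq> hid H" if "i < ?n" for i
    using inv[OF that] unfolding involution_def by auto
  have c_eq: "c b = rs" if "b \<in> carrier H" "is_components H ?Gs b rs" for b rs
    unfolding c_def components_def using the1_equality[OF ex1_components[OF d that(1)] that(2)] .
  have comp: "is_components H ?Gs b (c b)" if "b \<in> carrier H" for b
    unfolding c_def components_def by (rule theI'[OF ex1_components[OF d that]])
  then have len: "length (c b) = ?n"
    and mem: "i < ?n \<Longrightarrow> c b ! i \<in> {hid H, qs ! i}"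
    if "b \<in> carrier H" for b i
    unfolding comps using that by auto
  have memc: "c b ! i \<in> carrier H" if "b \<in> carrier H" "i < ?n" for b i
    using mem[OF that] q[OF that(2)] hid_closed by auto
  have sub: "hmult H (c a ! i) (c b ! i) \<subseteq> {hid H, qs ! i}"
    if "a \<in> carrier H" "b \<in> carrier H" "i < ?n" for a b i
    using closed_subsetD(4)[OF _ mem[OF that(1,3)] mem[OF that(2,3)]] inv[OF that(3)]
    unfolding involution_def by simp
  have hm: "x \<in> hmult H a b \<longleftrightarrow>
      x \<in> carrier H \<and> (\<forall>i<?n. c x ! i \<in> hmult H (c a ! i) (c b ! i))"
    if a: "a \<in> carrier H" and b: "b \<in> carrier H" for a b x
  proof -
    let ?h = "\<lambda>i. hmult H (c a ! i) (c b ! i)"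
    have P: "?P (c y) = lprod H (map (\<lambda>i. {c y ! i}) [0..<?n])" if "y \<in> carrier H" for y
    proof -
      have "map (\<lambda>r. {r}) (c y) = map (\<lambda>i. {c y ! i}) [0..<?n]"
        by (rule nth_equalityI) (use len[OF that] in auto)
      then show ?thesis by simp
    qed
    \<comment> \<open>Since the direct product is constrained, \<open>{a}\<close> and
      \<open>{b}\<close> equal the products of their components, and \<open>lprod_cprod\<close>
      multiplies these index by index.\<close>
    have "hmult H a b = ?P (c a) \<odot>\<^bsub>H\<^esub> ?P (c b)"
      using con a b by (simp add: cprod_singletons)
    also have "\<dots> = lprod H (map (\<lambda>i. {c a ! i} \<odot>\<^bsub>H\<^esub> {c b ! i}) [0..<?n])"
      unfolding P[OF a] P[OF b] by (rule lprod_cprod[OF st]) (use memc a b in auto)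
    finally have eq: "hmult H a b = lprod H (map ?h [0..<?n])" by (simp add: cprod_singletons)
    show ?thesis
    proof
      assume x: "x \<in> hmult H a b"
      then have xc: "x \<in> carrier H" using hmult_closed a b by blast
      obtain rs where rs: "is_components H (map ?h [0..<?n]) x rs"
        using lprod_components x eq by metis
      then have l: "length rs = ?n" and m: "\<And>i. i < ?n \<Longrightarrow> rs ! i \<in> ?h i" and xp: "x \<in> ?P rs"
        unfolding is_components_def list_all2_conv_all_nth by auto
      \<comment> \<open>The entries of \<open>rs\<close> were chosen from products inside the
        factors, so they are components of \<open>x\<close> in the original decomposition, and
        uniqueness identifies them with \<open>c x\<close>.\<close>
      then have "is_components H ?Gs x rs" unfolding comps using sub[OF a b] by blast
      then have "c x = rs" by (rule c_eq[OF xc])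
      then show "x \<in> carrier H \<and> (\<forall>i<?n. c x ! i \<in> ?h i)" using xc m by simp
    next
      assume x: "x \<in> carrier H \<and> (\<forall>i<?n. c x ! i \<in> ?h i)"
      then have "list_all2 (\<in>) (c x) (map ?h [0..<?n])"
        using len by (simp add: list_all2_conv_all_nth)
      then have "?P (c x) \<subseteq> hmult H a b" unfolding eq by (rule lprod_singletons_subset)
      then show "x \<in> hmult H a b" using con x by simp
    qed
  qed
  \<comment> \<open>The multiplication table of the factor at \<open>i\<close>, in terms of
    nontriviality. The disjuncts treat one, none or both of \<open>u\<close> and \<open>v\<close>
    being nontrivial.\<close>
  have pw: "z \<in> hmult H u v \<longleftrightarrow>
      (u \<noteq> hid H) \<noteq> (v \<noteq> hid H) \<and> z \<noteq> hid H \<or>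
      u = hid H \<and> v = hid H \<and> z = hid H \<or>
      u \<noteq> hid H \<and> v \<noteq> hid H \<and> (z \<noteq> hid H \<longrightarrow> i \<in> K)"
    if "i < ?n" "u \<in> {hid H, qs ! i}" "v \<in> {hid H, qs ! i}" "z \<in> {hid H, qs ! i}" for u v z i
  proof -
    have t: "hmult H (hid H) (hid H) = {hid H}" "hmult H (hid H) (qs ! i) = {qs ! i}"
      "hmult H (qs ! i) (hid H) = {qs ! i}"
      "hmult H (qs ! i) (qs ! i) = (if i \<in> K then {hid H, qs ! i} else {hid H})"
      using q[OF that(1)] hid_closed that(1) hmult_involution[OF inv[OF that(1)]]
      by (simp_all add: hmult_hid_left hmult_hid_right K_def)
    show ?thesis
      using that(2-4) by (elim insertE emptyE) (simp_all add: t q(2)[OF that(1)] not_sym)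
  qed
  have inj: "inj_on S (carrier H)"
  proof (rule inj_onI)
    fix a b assume a: "a \<in> carrier H" and b: "b \<in> carrier H" and eq: "S a = S b"
    have "c a = c b"
    proof (rule nth_equalityI)
      fix i assume "i < length (c a)"
      then have i: "i < ?n" using len[OF a] by simp
      have "c a ! i \<noteq> hid H \<longleftrightarrow> c b ! i \<noteq> hid H" using eq i unfolding S_def by blast
      then show "c a ! i = c b ! i" using mem[OF a i] mem[OF b i] by auto
    qed (use len a b in simp)
    \<comment> \<open>Constrainedness enters here: equal component lists have the same product,
      which is the singleton of each element.\<close>
    then have "?P (c a) = ?P (c b)" by (rule arg_cong)
    then show "a = b" unfolding con[OF a] con[OF b] by (rule singleton_inject)
  qed
  have surj: "U \<in> S ` carrier H" if U: "U \<subseteq> {..<?n}" for U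
  proof -
    let ?rs = "map (\<lambda>i. if i \<in> U then qs ! i else hid H) [0..<?n]"
    have rs: "set ?rs \<subseteq> carrier H" using q hid_closed by auto
    \<comment> \<open>Any element of this nonempty product will do, since uniqueness makes
      \<open>?rs\<close> its component list.\<close>
    then obtain a where a: "a \<in> ?P ?rs" using lprod_singletons_nonempty by blast
    have "?P ?rs \<subseteq> carrier H" by (rule lprod_singletons_closed[OF rs])
    with a have ac: "a \<in> carrier H" by blast
    have "is_components H ?Gs a ?rs" unfolding comps using a by simp
    then have "c a = ?rs" by (rule c_eq[OF ac])
    then have "S a = U" unfolding S_def using U q(2) by (auto split: if_splits)
    then show ?thesis using ac by blast
  qed
  show "set_coordinates H S {..<?n} K"
  proof unfold_locales
    show "bij_betw S (carrier H) (Pow {..<?n})"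
      unfolding bij_betw_def using inj surj by (auto simp: S_def)
    show "x \<in> hmult H a b \<longleftrightarrow> x \<in> carrier H \<and>
      (S a - S b) \<union> (S b - S a) \<subseteq> S x \<and> S x \<subseteq> (S a - S b) \<union> (S b - S a) \<union> (S a \<inter> S b \<inter> K)"
      if a: "a \<in> carrier H" and b: "b \<in> carrier H" for a b x
    proof (cases "x \<in> carrier H")
      case x: True
      \<comment> \<open>The two inclusions of \<open>mem_hmult\<close>, read at a single
        index.\<close>
      have "c x ! i \<in> hmult H (c a ! i) (c b ! i) \<longleftrightarrow>
          (i \<in> (S a - S b) \<union> (S b - S a) \<longrightarrow> i \<in> S x) \<and>
          (i \<in> S x \<longrightarrow> i \<in> (S a - S b) \<union> (S b - S a) \<union> (S a \<inter> S b \<inter> K))"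
        if i: "i < ?n" for i
        unfolding pw[OF i mem[OF a i] mem[OF b i] mem[OF x i]] using i by (auto simp: S_def)
      moreover have "S a \<subseteq> {..<?n}" "S b \<subseteq> {..<?n}" "S x \<subseteq> {..<?n}" unfolding S_def by auto
      ultimately show ?thesis unfolding hm[OF a b] using x by blast
    qed (simp add: hm[OF a b])
  qed (use st in auto)
  show "support H ?Gs a = (!) qs ` S a" if a: "a \<in> carrier H"
  proof -
    have "set (c a) = (!) (c a) ` {..<?n}" using len[OF a] by (auto simp: in_set_conv_nth)
    then have "support H ?Gs a = (!) (c a) ` S a"
      unfolding support_def c_def[symmetric] S_def by auto
    also have "\<dots> = (!) qs ` S a" using mem[OF a] by (intro image_cong) (auto simp: S_def)
    finally show ?thesis .
  qed
qed

section \<open>Closed sets and subgroups of the group of thin elements\<close>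

text \<open>Products of thin elements are singletons by \<open>thin_mult\<close> and stay in
  \<open>G\<close>; inverses are trivial because every group element squares to the
  identity.\<close>

lemma subgroup_singletons_thin_part:
  assumes E: "elementary_abelian_2_hypergroup H qs" and G: "closed_subset H G"
  shows "subgroup (singletons (thin_part H G)) (thin_group H)"
proof -
  interpret hypergroup H using E unfolding elementary_abelian_2_hypergroup_def by blast
  interpret T: comm_group "thin_group H" by (rule comm_group_thin_group[OF E])
  note dG = closed_subsetD[OF G]
  have mem: "X \<in> singletons (thin_part H G) \<longleftrightarrow> (\<exists>a\<in>G. thin H a \<and> X = {a})" for X
    unfolding singletons_def thin_part_def by auto
  have sub: "singletons (thin_part H G) \<subseteq> carrier (thin_group H)"
    unfolding thin_group_def singletons_def thin_part_def thin_def by auto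
  have "thin H (hid H)" unfolding thin_def by (simp add: star_hid hid_closed hmult_hid_left)
  then have one: "{hid H} \<in> singletons (thin_part H G)" unfolding mem using dG(2) by blast
  show ?thesis
  proof (rule T.subgroupI[OF sub])
    show "singletons (thin_part H G) \<noteq> {}" using one by blast
    fix X assume X: "X \<in> singletons (thin_part H G)"
    have "inv\<^bsub>thin_group H\<^esub> X = X"
      using X sub comm_group_thin_group(2)[OF E] by (intro T.inv_equality) auto
    then show "inv\<^bsub>thin_group H\<^esub> X \<in> singletons (thin_part H G)" using X by simp
    fix Y assume "Y \<in> singletons (thin_part H G)"
    with X obtain a b where ab: "a \<in> G" "thin H a" "X = {a}" "b \<in> G" "thin H b" "Y = {b}"
      unfolding mem by blast
    then obtain d where "hmult H a b = {d}" "thin H d" using thin_mult by blast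
    then show "X \<otimes>\<^bsub>thin_group H\<^esub> Y \<in> singletons (thin_part H G)"
      unfolding mem using ab dG(4)[of a b] by (auto simp: thin_group_def cprod_singletons)
  qed
qed

text \<open>Closure in the group says that the product of two elements of \<open>F\<close> is the
  singleton of an element of \<open>F\<close>; the star map is trivial.\<close>

lemma closed_if_subgroup_singletons:
  assumes E: "elementary_abelian_2_hypergroup H qs" and F: "F \<subseteq> carrier H"
    and sg: "subgroup (singletons F) (thin_group H)"
  shows "closed_subset H F"
proof -
  interpret hypergroup H using E unfolding elementary_abelian_2_hypergroup_def by blast
  have mem: "{a} \<in> singletons F \<longleftrightarrow> a \<in> F" for a unfolding singletons_def by auto
  show ?thesis
  proof (rule closed_subsetI[OF F])
    show "hid H \<in> F" using subgroup.one_closed[OF sg] mem by (simp add: thin_group_def)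
    show "star H x \<in> F" if "x \<in> F" for x using star_elementary[OF E] F that by auto
    show "hmult H x y \<subseteq> F" if "x \<in> F" "y \<in> F" for x y
    proof -
      have "hmult H x y \<in> singletons F"
        using subgroup.m_closed[OF sg, of "{x}" "{y}"] that mem
        by (simp add: thin_group_def cprod_singletons)
      then show ?thesis unfolding singletons_def by auto
    qed
  qed
qed

section \<open>Characterisation of closed subsets\<close>

theorem theorem3p12:
  fixes H :: "('a, 'b) hyperstructure_scheme" and qs :: "'a list" and G :: "'a set"
  assumes "elementary_abelian_2_hypergroup H qs"
    and "G \<subseteq> carrier H"
  shows "closed_subset H G \<longleftrightarrow>
    (\<exists>r \<in> Thick H qs (carrier H). \<exists>F. F \<subseteq> carrier H \<and>
       thin_residue H G = hgen H {r} \<and>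
       subgroup (singletons F) (thin_group H) \<and>
       G = hgen H {r} \<odot>\<^bsub>H\<^esub> F \<and>
       hgen H {r} \<inter> F = {hid H} \<and>
       thin_part H G = F)"
proof -
  note E = assms(1)
  interpret hypergroup H using E unfolding elementary_abelian_2_hypergroup_def by blast
  show ?thesis
  proof
    assume G: "closed_subset H G"
    let ?K = "{i. i < length qs \<and> thick H (qs ! i)}"
    define S where "S a = {i. i < length qs \<and> components H (factors H qs) a ! i \<noteq> hid H}" for a
    interpret set_coordinates H S "{..<length qs}" ?K
      unfolding S_def by (rule elementary_abelian_2_hypergroup_coordinates(1)[OF E])
    obtain r where r: "r \<in> G" "S r \<subseteq> ?K" and max: "\<And>a. a \<in> G \<Longrightarrow> S a \<inter> ?K \<subseteq> S r"
      using closed_obtain_largest_thick[OF G] by metis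
    have rc: "r \<in> carrier H" using r assms(2) by blast
    have "support H (factors H qs) r = (!) qs ` S r"
      unfolding S_def by (rule elementary_abelian_2_hypergroup_coordinates(2)[OF E rc])
    \<comment> \<open>The support of \<open>r\<close> consists of the involutions indexed by
      \<open>S r\<close>, all of which are thick.\<close>
    then have "r \<in> Thick H qs (carrier H)" unfolding Thick_def using rc r(2) by auto
    moreover have "thin_part H G \<subseteq> carrier H" unfolding thin_part_def using assms(2) by auto
    ultimately show "\<exists>r \<in> Thick H qs (carrier H). \<exists>F. F \<subseteq> carrier H \<and>
       thin_residue H G = hgen H {r} \<and> subgroup (singletons F) (thin_group H) \<and>
       G = hgen H {r} \<odot>\<^bsub>H\<^esub> F \<and> hgen H {r} \<inter> F = {hid H} \<and> thin_part H G = F"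
      using thin_residue_closed[OF G r max] subgroup_singletons_thin_part[OF E G]
        closed_decomposition[OF G r max] hgen_Int_thin_part[OF G rc r(2)] by blast
  next
    assume "\<exists>r \<in> Thick H qs (carrier H). \<exists>F. F \<subseteq> carrier H \<and>
       thin_residue H G = hgen H {r} \<and> subgroup (singletons F) (thin_group H) \<and>
       G = hgen H {r} \<odot>\<^bsub>H\<^esub> F \<and> hgen H {r} \<inter> F = {hid H} \<and> thin_part H G = F"
    then obtain r F where r: "r \<in> Thick H qs (carrier H)" and F: "F \<subseteq> carrier H"
      and sg: "subgroup (singletons F) (thin_group H)" and G: "G = hgen H {r} \<odot>\<^bsub>H\<^esub> F"
      by blast
    have "closed_subset H (hgen H {r})" using closed_hgen r unfolding Thick_def by simp
    moreover have "closed_subset H F" by (rule closed_if_subgroup_singletons[OF E F sg])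
    \<comment> \<open>Both factors are normal because multiplication is commutative, so their
      product is a closed subset.\<close>
    ultimately have "normal_in H (hgen H {r} \<odot>\<^bsub>H\<^esub> F) (carrier H)"
      by (intro normal_cprod closed_normal_in_carrier star_elementary[OF E])
    then show "closed_subset H G" unfolding G normal_in_def by blast
  qed
qed

end
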